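(* For every $n\geq 3$, determining sets have the exchange property in the $n$-wheel $W_n$: whenever $S$ and $R$ are minimal determining sets of $W_n$ and $r\in R$, there exists $s\in S$ such that $(S\setminus\{s\})\cup\{r\}$ is a minimal determining set of $W_n$.
   Context: The $n$-wheel $W_n$ ($n\geq 3$) is the join of the cycle $C_n$ with $K_1$: an $n$-cycle together with one additional vertex adjacent to every vertex of the cycle. A set $S\subseteq V(G)$ is a determining set if the only automorphism of $G$ fixing every vertex of $S$ is the identity (equivalently, any two automorphisms agreeing on $S$ are equal); it is minimal if no proper subset is a determining set. *)

theory Defs
  imports Main
begin

record 'a graph =
  verts :: "'a set"
  edges :: "'a set set"

definition simple_graph :: "'a graph \<Rightarrow> bool" where
  "simple_graph G \<longleftrightarrow> (\<forall>e \<in> edges G. e \<subseteq> verts G \<and> card e = 2)"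

text \<open>For \<open>n < 3\<close> the following is not a cycle (there is a loop for \<open>n = 1\<close>).\<close>

definition cycle_graph :: "nat \<Rightarrow> nat graph" where
  "cycle_graph n = \<lparr>verts = {..<n}, edges = {{i, Suc i mod n} | i. i < n}\<rparr>"

definition K1 :: "unit graph" where
  "K1 = \<lparr>verts = UNIV, edges = {}\<rparr>"

definition graph_join :: "'a graph \<Rightarrow> 'b graph \<Rightarrow> ('a + 'b) graph" where
  "graph_join G H =
     \<lparr>verts = verts G <+> verts H,
      edges = (image Inl) ` edges G \<union> (image Inr) ` edges H
              \<union> {{Inl u, Inr v} | u v. u \<in> verts G \<and> v \<in> verts H}\<rparr>"

definition wheel :: "nat \<Rightarrow> (nat + unit) graph" where
  "wheel n = graph_join (cycle_graph n) K1"

text \<open>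
  An automorphism is a total function of which only the values on the vertex set matter;
  accordingly being the identity is required on the vertex set only.
\<close>

definition automorphism :: "'a graph \<Rightarrow> ('a \<Rightarrow> 'a) \<Rightarrow> bool" where
  "automorphism G f \<longleftrightarrow>
     bij_betw f (verts G) (verts G) \<and>
     (\<forall>u \<in> verts G. \<forall>v \<in> verts G. {f u, f v} \<in> edges G \<longleftrightarrow> {u, v} \<in> edges G)"

definition determining_set :: "'a graph \<Rightarrow> 'a set \<Rightarrow> bool" where
  "determining_set G S \<longleftrightarrow>
     S \<subseteq> verts G \<and>
     (\<forall>f. automorphism G f \<longrightarrow> (\<forall>s \<in> S. f s = s) \<longrightarrow> (\<forall>v \<in> verts G. f v = v))"

definition minimal_determining_set :: "'a graph \<Rightarrow> 'a set \<Rightarrow> bool" where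
  "minimal_determining_set G S \<longleftrightarrow>
     determining_set G S \<and> (\<forall>T. T \<subset> S \<longrightarrow> \<not> determining_set G T)"

definition determining_exchange_property :: "'a graph \<Rightarrow> bool" where
  "determining_exchange_property G \<longleftrightarrow>
     (\<forall>S R. minimal_determining_set G S \<longrightarrow> minimal_determining_set G R \<longrightarrow>
        (\<forall>r \<in> R. \<exists>s \<in> S. minimal_determining_set G ((S - {s}) \<union> {r})))"

lemma simple_graph_cycle:
  assumes "n \<ge> 3"
  shows "simple_graph (cycle_graph n)"
proof -
  have "i \<noteq> Suc i mod n" "Suc i mod n < n" if "i < n" for i
    using assms that by (auto simp: mod_Suc)
  then show ?thesis
    by (auto simp: simple_graph_def cycle_graph_def card_2_iff)
qed

lemma simple_graph_join:
  assumes "simple_graph G" "simple_graph H"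
  shows "simple_graph (graph_join G H)"
  using assms unfolding simple_graph_def graph_join_def
  by (fastforce simp: card_image)

lemma simple_graph_wheel: "n \<ge> 3 \<Longrightarrow> simple_graph (wheel n)"
  unfolding wheel_def
  by (intro simple_graph_join simple_graph_cycle) (simp_all add: simple_graph_def K1_def)

end

theory Submission
  imports Defs
begin

text \<open>
  For \<open>n \<ge> 4\<close> every automorphism of the wheel fixes the hub, and an automorphism that fixes a
  rim vertex \<open>i\<close> is either the identity or the reflection in \<open>i\<close>, which fixes exactly the hub and
  the rim vertices \<open>j\<close> with \<open>n dvd 2 * (i - j)\<close>.  This relation is an equivalence, and the minimal
  determining sets are the pairs of inequivalent rim vertices.  A vertex \<open>r\<close> cannot be equivalent
  to both members of such a pair, which gives the exchange.  The wheel on three spokes is the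
  complete graph on four vertices, where the hub is not distinguished; there the minimal
  determining sets are the complements of single vertices.
\<close>

subsection \<open>Complete graphs\<close>

definition complete_graph :: "'a graph \<Rightarrow> bool" where
  "complete_graph G \<longleftrightarrow>
     (\<forall>u \<in> verts G. \<forall>v \<in> verts G. {u, v} \<in> edges G \<longleftrightarrow> u \<noteq> v)"

text \<open>Transposing two vertices outside \<open>S\<close> is an automorphism fixing
  \<open>S\<close>. Conversely, if at most one vertex lies outside \<open>S\<close>, an automorphism
  fixing \<open>S\<close> can only move it into \<open>S\<close>, where its image is already
  taken.\<close>

lemma determining_set_complete_graph:
  assumes "complete_graph G"
  shows "determining_set G S \<longleftrightarrow>
    S \<subseteq> verts G \<and> (\<forall>a \<in> verts G - S. \<forall>b \<in> verts G - S. a = b)"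
proof (intro iffI conjI ballI)
  assume det: "determining_set G S"
  then show "S \<subseteq> verts G"
    by (simp add: determining_set_def)
  fix a b assume ab: "a \<in> verts G - S" "b \<in> verts G - S"
  define f where "f = id(a := b, b := a)"
  have "bij_betw f (verts G) (verts G)"
    using ab by (intro bij_betw_byWitness[where f' = f]) (auto simp: f_def)
  moreover have "{f u, f v} \<in> edges G \<longleftrightarrow> {u, v} \<in> edges G"
    if "u \<in> verts G" "v \<in> verts G" for u v
  proof -
    have "f u \<in> verts G" "f v \<in> verts G" "f u = f v \<longleftrightarrow> u = v"
      using ab that by (auto simp: f_def)
    then show ?thesis
      using assms that by (simp add: complete_graph_def)
  qed
  ultimately have "automorphism G f"
    by (simp add: automorphism_def)
  moreover have "\<forall>s \<in> S. f s = s"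
    using ab by (auto simp: f_def)
  ultimately have "f a = a"
    using det ab unfolding determining_set_def by blast
  then show "a = b"
    by (simp add: f_def split: if_splits)
next
  assume R: "S \<subseteq> verts G \<and> (\<forall>a \<in> verts G - S. \<forall>b \<in> verts G - S. a = b)"
  have "f v = v" if f: "automorphism G f" "\<forall>s \<in> S. f s = s" and v: "v \<in> verts G" for f v
  proof (rule ccontr)
    assume neq: "f v \<noteq> v"
    have bij: "bij_betw f (verts G) (verts G)"
      using f(1) by (simp add: automorphism_def)
    have fv: "f v \<in> verts G"
      using bij v by (auto simp: bij_betw_def)
    have "v \<notin> S"
      using neq f(2) by auto
    then have "f v \<in> S"
      using R v fv neq by blast
    then have "f (f v) = f v"
      using f(2) by simp
    then show False
      using bij v fv neq by (metis bij_betw_imp_inj_on inj_onD)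
  qed
  then show "determining_set G S"
    using R by (auto simp: determining_set_def)
qed

text \<open>The empty graph is excluded because there the empty set is minimal determining but is
  not the complement of a single vertex.\<close>

lemma minimal_determining_set_complete_graph:
  assumes "complete_graph G" "verts G \<noteq> {}"
  shows "minimal_determining_set G S \<longleftrightarrow> (\<exists>a \<in> verts G. S = verts G - {a})"
proof
  assume min: "minimal_determining_set G S"
  then have S: "S \<subseteq> verts G" "\<forall>a \<in> verts G - S. \<forall>b \<in> verts G - S. a = b"
    using assms by (auto simp: minimal_determining_set_def determining_set_complete_graph)
  have "S \<noteq> verts G"
  proof
    assume "S = verts G"
    moreover obtain a where "a \<in> verts G"
      using assms by blast
    moreover from this have "determining_set G (verts G - {a})"
      using assms by (auto simp: determining_set_complete_graph)
    ultimately show False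
      using min unfolding minimal_determining_set_def by blast
  qed
  then show "\<exists>a \<in> verts G. S = verts G - {a}"
    using S by blast
next
  assume "\<exists>a \<in> verts G. S = verts G - {a}"
  then show "minimal_determining_set G S"
    unfolding minimal_determining_set_def determining_set_complete_graph[OF assms(1)] by blast
qed

lemma determining_exchange_property_complete_graph:
  assumes "complete_graph G" "a \<in> verts G" "b \<in> verts G" "a \<noteq> b"
  shows "determining_exchange_property G"
proof -
  have ne: "verts G \<noteq> {}"
    using assms by blast
  show ?thesis
    unfolding determining_exchange_property_def
      minimal_determining_set_complete_graph[OF assms(1) ne]
  proof (intro allI impI ballI, elim bexE)
    fix S R r x y
    assume *: "r \<in> R" "x \<in> verts G" "S = verts G - {x}" "R = verts G - {y}"
    \<comment> \<open>If \<open>r\<close> is the vertex \<open>x\<close> missing from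
      \<open>S\<close>, any \<open>z\<close> in \<open>S\<close> may be given up for it; otherwise
      \<open>r\<close> is exchanged for itself.\<close>
    obtain z where z: "z \<in> verts G" "z \<noteq> x"
      using assms by metis
    show "\<exists>s \<in> S. \<exists>a \<in> verts G. S - {s} \<union> {r} = verts G - {a}"
    proof (cases "r = x")
      case True
      then have "z \<in> S" "S - {z} \<union> {r} = verts G - {z}"
        using * z by auto
      then show ?thesis
        using z by blast
    next
      case False
      then have "r \<in> S" "S - {r} \<union> {r} = verts G - {x}"
        using * by auto
      then show ?thesis
        using * by blast
    qed
  qed
qed

subsection \<open>Adjacency in the wheel\<close>

text \<open>Cyclic succession becomes an integer divisibility, so that later arguments can add and
  subtract congruences without truncated subtraction.\<close>

lemma Suc_mod_eq_iff_dvd: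
  assumes "v < n"
  shows "v = Suc u mod n \<longleftrightarrow> int n dvd int v - int u - 1"
proof -
  have "v = Suc u mod n \<longleftrightarrow> int v mod int n = int (Suc u) mod int n"
    using assms by (metis mod_less of_nat_eq_iff of_nat_mod)
  also have "\<dots> \<longleftrightarrow> int n dvd int v - int u - 1"
    by (simp add: mod_eq_dvd_iff algebra_simps)
  finally show ?thesis .
qed

lemma verts_wheel: "verts (wheel n) = Inl ` {..<n} \<union> {Inr ()}"
  by (auto simp: wheel_def graph_join_def cycle_graph_def K1_def)

lemma wheel_rim_edge_iff:
  assumes "u < n" "v < n"
  shows "{Inl u, Inl v} \<in> edges (wheel n) \<longleftrightarrow>
    int n dvd int v - int u - 1 \<or> int n dvd int v - int u + 1"
proof -
  \<comment> \<open>Spokes contain \<open>Inr ()\<close>, and \<open>K1\<close> has no edges, so an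
    edge between rim vertices comes from the cycle.\<close>
  have "{Inl u, Inl v} \<in> edges (wheel n) \<longleftrightarrow>
      Inl ` {u, v} \<in> image (Inl :: nat \<Rightarrow> nat + unit) ` edges (cycle_graph n)"
    by (simp add: wheel_def graph_join_def K1_def doubleton_eq_iff)
  also have "\<dots> \<longleftrightarrow> {u, v} \<in> edges (cycle_graph n)"
    by (rule inj_image_mem_iff) (simp add: inj_on_image)
  also have "\<dots> \<longleftrightarrow> v = Suc u mod n \<or> u = Suc v mod n"
    unfolding cycle_graph_def graph.simps mem_Collect_eq doubleton_eq_iff using assms by blast
  also have "\<dots> \<longleftrightarrow> int n dvd int v - int u - 1 \<or> int n dvd int u - int v - 1"
    using assms by (simp add: Suc_mod_eq_iff_dvd)
  also have "int n dvd int u - int v - 1 \<longleftrightarrow> int n dvd int v - int u + 1"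
    using dvd_minus_iff[of "int n" "int u - int v - 1"] by (simp add: algebra_simps)
  finally show ?thesis .
qed

lemma wheel_hub_edge:
  assumes "u < n"
  shows "{Inl u, Inr ()} \<in> edges (wheel n)" "{Inr (), Inl u} \<in> edges (wheel n)"
proof -
  show "{Inl u, Inr ()} \<in> edges (wheel n)"
    using assms by (auto simp: wheel_def graph_join_def cycle_graph_def K1_def)
  then show "{Inr (), Inl u} \<in> edges (wheel n)"
    by (simp only: insert_commute)
qed

lemma wheel_hub_no_loop: "{Inr ()} \<notin> edges (wheel n)"
  by (auto simp: wheel_def graph_join_def cycle_graph_def K1_def)

text \<open>Modulo 3 the differences 1 and -1 are all the nonzero residues, so any two distinct rim
  vertices are adjacent.\<close>

lemma complete_graph_wheel_3: "complete_graph (wheel 3)"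
proof -
  have rim: "{Inl u, Inl v} \<in> edges (wheel 3) \<longleftrightarrow> u \<noteq> v" if "u < 3" "v < 3" for u v
  proof -
    have "u = 0 \<or> u = 1 \<or> u = 2" "v = 0 \<or> v = 1 \<or> v = 2"
      using that by auto
    then show ?thesis
      using wheel_rim_edge_iff[OF that] by (elim disjE) simp_all
  qed
  show ?thesis
    unfolding complete_graph_def
  proof (intro ballI)
    fix u v assume "u \<in> verts (wheel 3)" "v \<in> verts (wheel 3)"
    then show "{u, v} \<in> edges (wheel 3) \<longleftrightarrow> u \<noteq> v"
      using rim wheel_hub_edge[of _ 3] wheel_hub_no_loop[of 3]
      by (auto simp: verts_wheel)
  qed
qed

subsection \<open>Automorphisms of the wheel\<close>

text \<open>The hub is adjacent to every other vertex, whereas for \<open>n \<ge> 4\<close> the rim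
  vertex \<open>i\<close> is neither equal nor adjacent to the one two places further on.\<close>

lemma wheel_automorphism_hub:
  assumes "n \<ge> 4" "automorphism (wheel n) f"
  shows "f (Inr ()) = Inr ()"
proof (rule ccontr)
  assume neq: "f (Inr ()) \<noteq> Inr ()"
  have bij: "bij_betw f (verts (wheel n)) (verts (wheel n))"
    using assms by (simp add: automorphism_def)
  have "f (Inr ()) \<in> verts (wheel n)"
    using bij by (auto simp: bij_betw_def verts_wheel)
  then obtain i where i: "i < n" "f (Inr ()) = Inl i"
    using neq by (auto simp: verts_wheel)
  define j where "j = nat ((int i + 2) mod int n)"
  have j: "j < n" "int j = (int i + 2) mod int n"
    using assms by (auto simp: j_def nat_less_iff)
  then have "int j mod int n = (int i + 2) mod int n"
    by simp
  then have dj: "int n dvd int j - (int i + 2)"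
    by (simp add: mod_eq_dvd_iff)
  \<comment> \<open>The preimage of \<open>Inl j\<close> is not the hub, which goes to
    \<open>Inl i\<close>; it is therefore joined to the hub, and this spoke would be mapped to an
    edge between \<open>i\<close> and \<open>j\<close>.\<close>
  have "Inl j \<in> f ` verts (wheel n)"
    using bij j by (auto simp: bij_betw_def verts_wheel)
  then obtain x where x: "x \<in> verts (wheel n)" "f x = Inl j"
    by auto
  have "i \<noteq> j"
  proof
    assume "i = j"
    then have "int n dvd 2"
      using dj by (simp add: algebra_simps)
    then show False
      using assms zdvd_imp_le by fastforce
  qed
  then obtain u where u: "u < n" "x = Inl u"
    using x i by (auto simp: verts_wheel)
  have "{f (Inr ()), f (Inl u)} \<in> edges (wheel n)"
    using assms(2) u wheel_hub_edge[of u n] x(1)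
    by (auto simp: automorphism_def verts_wheel)
  then have "{Inl i, Inl j} \<in> edges (wheel n)"
    using i u x by simp
  then have "int n dvd int j - int i - 1 \<or> int n dvd int j - int i + 1"
    using i j by (simp add: wheel_rim_edge_iff)
  \<comment> \<open>Since \<open>j\<close> is \<open>i + 2\<close> modulo \<open>n\<close>,
    adjacency forces \<open>n\<close> to divide 1 or 3.\<close>
  then have "int n dvd (int j - int i - 1) - (int j - (int i + 2)) \<or>
      int n dvd (int j - int i + 1) - (int j - (int i + 2))"
    using dj dvd_diff by blast
  then have "int n dvd 1 \<or> int n dvd 3"
    by simp
  then show False
    using assms(1) zdvd_imp_le by fastforce
qed

text \<open>A walk on the residues modulo \<open>n\<close> with steps 1 and -1 that is injective
  modulo \<open>n\<close> cannot turn around: a turn would give positions \<open>k\<close> and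
  \<open>k + 2\<close> the same residue, although \<open>n > 2\<close>. The first step thus fixes
  the direction \<open>e\<close>.\<close>

lemma cyclic_walk_is_translation_or_reflection:
  fixes n :: int and G :: "int \<Rightarrow> int"
  assumes "n > 2"
    and step: "\<And>k. n dvd G (k + 1) - G k - 1 \<or> n dvd G (k + 1) - G k + 1"
    and inj: "\<And>k l. n dvd G k - G l \<Longrightarrow> n dvd k - l"
  shows "\<exists>e. (e = 1 \<or> e = -1) \<and> (\<forall>m::nat. n dvd G (i + int m) - G i - e * int m)"
proof -
  obtain e where e: "e = 1 \<or> e = -1" "n dvd G (i + 1) - G i - e"
  proof (cases "n dvd G (i + 1) - G i - 1")
    case True
    then show ?thesis using that[of 1] by simp
  next
    case False
    then show ?thesis using that[of "-1"] step[of i] by simp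
  qed
  \<comment> \<open>The induction carries the direction of the next step along with the closed
    form.\<close>
  have both: "n dvd G (i + int m) - G i - e * int m \<and>
      n dvd G (i + int m + 1) - G (i + int m) - e" for m :: nat
  proof (induction m)
    case 0
    then show ?case using e by simp
  next
    case (Suc m)
    have "n dvd (G (i + int m) - G i - e * int m) + (G (i + int m + 1) - G (i + int m) - e)"
      using dvd_add[OF conjunct1[OF Suc] conjunct2[OF Suc]] .
    then have 1: "n dvd G (i + int (Suc m)) - G i - e * int (Suc m)"
      by (simp add: algebra_simps)
    have 2: "n dvd G (i + int m + 1 + 1) - G (i + int m + 1) - e"
    proof (rule ccontr)
      assume "\<not> ?thesis"
      \<comment> \<open>The only alternative to a step by \<open>e\<close> is a step by
        \<open>-e\<close>, which would cancel the preceding one.\<close>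
      then have "n dvd G (i + int m + 1 + 1) - G (i + int m + 1) + e"
        using step[of "i + int m + 1"] e(1) by auto
      then have "n dvd (G (i + int m + 1 + 1) - G (i + int m + 1) + e) +
          (G (i + int m + 1) - G (i + int m) - e)"
        using conjunct2[OF Suc] by (rule dvd_add)
      then have "n dvd G (i + int m + 1 + 1) - G (i + int m)"
        by (simp add: algebra_simps)
      then have "n dvd (i + int m + 1 + 1) - (i + int m)"
        by (rule inj)
      then have "n dvd 2"
        by simp
      then show False
        using assms(1) zdvd_imp_le by fastforce
    qed
    show ?case
      using 1 2 by (simp add: algebra_simps)
  qed
  then show ?thesis
    using e(1) by blast
qed

lemma eq_if_less_if_dvd_diff:
  assumes "a < n" "b < n" "int n dvd int a - int b"
  shows "a = b"
proof -
  have "int a mod int n = int b mod int n"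
    using assms by (simp only: mod_eq_dvd_iff)
  then show ?thesis
    using assms by simp
qed

text \<open>On the rim the automorphism is \<open>i + e * (x - i)\<close> modulo \<open>n\<close>
  with \<open>e\<close> equal to 1 or -1. The value -1 would make the fixed vertex \<open>j\<close>
  satisfy the divisibility that \<open>sep\<close> forbids.\<close>

lemma wheel_automorphism_identity:
  assumes n: "n \<ge> 4" and f: "automorphism (wheel n) f"
    and ij: "i < n" "j < n" "f (Inl i) = Inl i" "f (Inl j) = Inl j"
    and sep: "\<not> int n dvd 2 * (int i - int j)"
    and v: "v \<in> verts (wheel n)"
  shows "f v = v"
proof -
  have hub: "f (Inr ()) = Inr ()"
    using wheel_automorphism_hub n f .
  have bij: "bij_betw f (verts (wheel n)) (verts (wheel n))"
    using f by (simp add: automorphism_def)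
  have "\<exists>y. y < n \<and> f (Inl x) = Inl y" if "x < n" for x
  proof -
    have "f (Inl x) \<in> verts (wheel n)"
      using bij that by (auto simp: bij_betw_def verts_wheel)
    moreover have "f (Inl x) \<noteq> f (Inr ())"
      using inj_onD[OF bij_betw_imp_inj_on[OF bij], of "Inl x" "Inr ()"] that
      by (auto simp: verts_wheel)
    ultimately show ?thesis
      using hub by (auto simp: verts_wheel)
  qed
  then obtain g where g: "\<And>x. x < n \<Longrightarrow> g x < n" "\<And>x. x < n \<Longrightarrow> f (Inl x) = Inl (g x)"
    by metis
  \<comment> \<open>Extending the rim map periodically to all integers turns it into a walk with no
    special case at the wrap-around.\<close>
  define rep where "rep k = nat (k mod int n)" for k
  have rep: "rep k < n" "int n dvd int (rep k) - k" for k
    using n by (auto simp: rep_def nat_less_iff mod_eq_dvd_iff[symmetric])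
  have rep_int: "rep (int x) = x" if "x < n" for x
    using that by (simp add: rep_def)
  define G where "G k = int (g (rep k))" for k
  have step: "int n dvd G (k + 1) - G k - 1 \<or> int n dvd G (k + 1) - G k + 1" for k
  proof -
    have "int n dvd (int (rep (k + 1)) - (k + 1)) - (int (rep k) - k)"
      by (rule dvd_diff[OF rep(2) rep(2)])
    then have "int n dvd int (rep (k + 1)) - int (rep k) - 1"
      by (simp add: algebra_simps)
    then have "{Inl (rep k), Inl (rep (k + 1))} \<in> edges (wheel n)"
      using rep by (simp add: wheel_rim_edge_iff)
    then have "{f (Inl (rep k)), f (Inl (rep (k + 1)))} \<in> edges (wheel n)"
      using f rep by (auto simp: automorphism_def verts_wheel)
    then show ?thesis
      using rep g by (simp add: wheel_rim_edge_iff G_def)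
  qed
  have inj: "int n dvd k - l" if "int n dvd G k - G l" for k l
  proof -
    have "g (rep k) = g (rep l)"
      using that rep g by (intro eq_if_less_if_dvd_diff[of _ n]) (auto simp: G_def)
    then have "f (Inl (rep k)) = f (Inl (rep l))"
      using g rep by simp
    then have eq: "rep k = rep l"
      using inj_onD[OF bij_betw_imp_inj_on[OF bij], of "Inl (rep k)" "Inl (rep l)"] rep(1)
      by (simp add: verts_wheel)
    have "int n dvd (int (rep l) - l) - (int (rep k) - k)"
      by (rule dvd_diff[OF rep(2) rep(2)])
    then show ?thesis
      using eq by simp
  qed
  have "int n > 2"
    using n by simp
  then obtain e where e: "e = 1 \<or> e = -1"
      "\<And>m::nat. int n dvd G (int i + int m) - G (int i) - e * int m"
    using cyclic_walk_is_translation_or_reflection[where n = "int n" and G = G and i = "int i",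
        OF _ step inj] by blast
  have Gi: "G (int i) = int i"
    using ij g(2)[of i] by (simp add: G_def rep_int)
  have key: "int n dvd int (g x) - int i - e * (int x - int i)" if "x < n" for x
  proof -
    \<comment> \<open>Adding \<open>n\<close> prevents truncation when \<open>x < i\<close> and
      leaves the residue unchanged; the extra \<open>e * int n\<close> is removed below.\<close>
    define m where "m = x + n - i"
    have m: "int m = int x - int i + int n"
      using ij by (simp add: m_def)
    have "rep (int i + int m) = rep (int x)"
      by (simp add: rep_def m)
    then have "G (int i + int m) = int (g x)"
      using that by (simp add: G_def rep_int)
    then have "int n dvd int (g x) - int i - e * int m"
      using e(2)[of m] Gi by simp
    then have "int n dvd (int (g x) - int i - e * int m) + e * int n"
      by (rule dvd_add) simp
    then show ?thesis
      by (simp add: m algebra_simps)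
  qed
  have "e = 1"
  proof (rule ccontr)
    assume "e \<noteq> 1"
    then have "e = -1"
      using e by simp
    then have "int n dvd 2 * (int j - int i)"
      using key[of j] ij g(2)[of j] by (simp add: algebra_simps)
    then have "int n dvd - (2 * (int j - int i))"
      by (simp only: dvd_minus_iff)
    then show False
      using sep by (simp add: algebra_simps)
  qed
  then have "g x = x" if "x < n" for x
    using key[OF that] g(1) that by (intro eq_if_less_if_dvd_diff[of _ n]) auto
  then show ?thesis
    using v hub g by (auto simp: verts_wheel)
qed

text \<open>The axis passes through the rim vertex \<open>i\<close>. Integers are used because
  \<open>2 * i - x\<close> may be negative.\<close>

definition wheel_reflection :: "nat \<Rightarrow> nat \<Rightarrow> nat + unit \<Rightarrow> nat + unit" where
  "wheel_reflection n i = map_sum (\<lambda>x. nat ((2 * int i - int x) mod int n)) id"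

lemma wheel_reflection_simps:
  "wheel_reflection n i (Inl x) = Inl (nat ((2 * int i - int x) mod int n))"
  "wheel_reflection n i (Inr u) = Inr u"
  by (simp_all add: wheel_reflection_def)

lemma wheel_reflection_fixes_iff:
  assumes "x < n"
  shows "wheel_reflection n i (Inl x) = Inl x \<longleftrightarrow> int n dvd 2 * (int i - int x)"
proof -
  have "wheel_reflection n i (Inl x) = Inl x \<longleftrightarrow>
      (2 * int i - int x) mod int n = int x mod int n"
    using assms by (auto simp: wheel_reflection_simps nat_eq_iff)
  also have "\<dots> \<longleftrightarrow> int n dvd 2 * (int i - int x)"
    by (simp add: mod_eq_dvd_iff algebra_simps)
  finally show ?thesis .
qed

lemma automorphism_wheel_reflection:
  assumes "n > 0"
  shows "automorphism (wheel n) (wheel_reflection n i)"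
proof -
  define r where "r x = nat ((2 * int i - int x) mod int n)" for x
  have r: "r x < n" "int (r x) = (2 * int i - int x) mod int n" for x
    using assms by (auto simp: r_def nat_less_iff)
  have rd: "int n dvd int (r x) - (2 * int i - int x)" for x
    using r by (simp add: mod_eq_dvd_iff[symmetric])
  have F: "wheel_reflection n i (Inl x) = Inl (r x)" for x
    by (simp add: wheel_reflection_simps r_def)
  \<comment> \<open>The reflection is an involution, hence its own inverse in the proof of
    bijectivity.\<close>
  have rr: "r (r x) = x" if "x < n" for x
  proof (rule eq_if_less_if_dvd_diff[OF r(1) that])
    have "int n dvd (int (r (r x)) - (2 * int i - int (r x))) - (int (r x) - (2 * int i - int x))"
      by (rule dvd_diff[OF rd rd])
    then show "int n dvd int (r (r x)) - int x"
      by simp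
  qed
  have "bij_betw (wheel_reflection n i) (verts (wheel n)) (verts (wheel n))"
    using r rr by (intro bij_betw_byWitness[where f' = "wheel_reflection n i"])
      (auto simp: verts_wheel F wheel_reflection_simps(2))
  moreover have "{Inl (r u), Inl (r v)} \<in> edges (wheel n) \<longleftrightarrow> {Inl u, Inl v} \<in> edges (wheel n)"
    if "u < n" "v < n" for u v
  proof -
    have "int n dvd (int (r u) - (2 * int i - int u)) - (int (r v) - (2 * int i - int v))"
      by (rule dvd_diff[OF rd rd])
    then have d: "int n dvd (int (r u) - int (r v)) - (int v - int u)"
      by (simp add: algebra_simps)
    \<comment> \<open>Reflection negates differences modulo \<open>n\<close>, so the image edge read
      backwards satisfies the same two divisibilities as the original edge.\<close>
    have "int n dvd (int (r u) - int (r v)) + c \<longleftrightarrow> int n dvd (int v - int u) + c" for c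
      using dvd_add_right_iff[OF d, of "int v - int u + c"] by (simp add: algebra_simps)
    from this[of "-1"] this[of 1] show ?thesis
      using that r wheel_rim_edge_iff[of "r v" n "r u"] wheel_rim_edge_iff[of u n v]
      by (simp add: insert_commute)
  qed
  ultimately show ?thesis
    using r wheel_hub_edge[of _ n] wheel_hub_no_loop[of n]
    by (auto simp: automorphism_def verts_wheel F wheel_reflection_simps(2))
qed

subsection \<open>Determining sets of the wheel\<close>

text \<open>If all rim vertices in \<open>S\<close> are equivalent to one \<open>i\<close>, the
  reflection in \<open>i\<close> fixes \<open>S\<close> but is not the identity. Two inequivalent
  ones rule out everything but the identity.\<close>

lemma determining_set_wheel:
  assumes n: "n \<ge> 4"
  shows "determining_set (wheel n) S \<longleftrightarrow> S \<subseteq> verts (wheel n) \<and>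
    (\<exists>i j. Inl i \<in> S \<and> Inl j \<in> S \<and> \<not> int n dvd 2 * (int i - int j))"
proof (intro iffI conjI)
  assume det: "determining_set (wheel n) S"
  then show sub: "S \<subseteq> verts (wheel n)"
    by (simp add: determining_set_def)
  show "\<exists>i j. Inl i \<in> S \<and> Inl j \<in> S \<and> \<not> int n dvd 2 * (int i - int j)"
  proof (rule ccontr)
    assume none: "\<not> ?thesis"
    \<comment> \<open>Any rim vertex of \<open>S\<close> serves as \<open>i\<close>; if there is
      none, the condition is vacuous and \<open>i\<close> is arbitrary.\<close>
    obtain i where i: "\<And>x. Inl x \<in> S \<Longrightarrow> int n dvd 2 * (int i - int x)"
      using none by blast
    have "\<forall>s \<in> S. wheel_reflection n i s = s"
      using sub i
      by (auto simp: verts_wheel wheel_reflection_simps(2) wheel_reflection_fixes_iff)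
    then have fix_all: "\<forall>v \<in> verts (wheel n). wheel_reflection n i v = v"
      using det automorphism_wheel_reflection[of n i] n
      unfolding determining_set_def by force
    have all: "int n dvd 2 * (int i - int x)" if "x < n" for x
      using fix_all that by (auto simp: verts_wheel wheel_reflection_fixes_iff)
    \<comment> \<open>A reflection fixing the neighbours 0 and 1 would force \<open>n\<close> to
      divide 2.\<close>
    have "int n dvd 2 * (int i - int 0) - 2 * (int i - int 1)"
      using n by (intro dvd_diff[OF all all]) auto
    then have "int n dvd 2"
      by (simp add: algebra_simps)
    then show False
      using n zdvd_imp_le by fastforce
  qed
next
  assume R: "S \<subseteq> verts (wheel n) \<and>
    (\<exists>i j. Inl i \<in> S \<and> Inl j \<in> S \<and> \<not> int n dvd 2 * (int i - int j))"
  then obtain i j where ij: "Inl i \<in> S" "Inl j \<in> S" "\<not> int n dvd 2 * (int i - int j)"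
    by blast
  then have lt: "i < n" "j < n"
    using R by (auto simp: verts_wheel)
  then show "determining_set (wheel n) S"
    using R ij wheel_automorphism_identity[OF n _ lt _ _ ij(3)]
    by (auto simp: determining_set_def)
qed

lemma determining_set_wheel_pair:
  assumes "n \<ge> 4" "i < n" "j < n" "\<not> int n dvd 2 * (int i - int j)"
  shows "determining_set (wheel n) {Inl i, Inl j}"
  unfolding determining_set_wheel[OF assms(1)] using assms
  by (intro conjI exI[of _ i] exI[of _ j]) (simp_all add: verts_wheel)

text \<open>Every determining set contains an inequivalent pair, which already determines. A proper
  subset of such a pair lacks two distinct rim vertices. In particular the hub lies in no minimal
  determining set.\<close>

lemma minimal_determining_set_wheel:
  assumes n: "n \<ge> 4"
  shows "minimal_determining_set (wheel n) S \<longleftrightarrow>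
    (\<exists>i j. i < n \<and> j < n \<and> S = {Inl i, Inl j} \<and> \<not> int n dvd 2 * (int i - int j))"
proof
  assume min: "minimal_determining_set (wheel n) S"
  then have "determining_set (wheel n) S"
    by (simp add: minimal_determining_set_def)
  from iffD1[OF determining_set_wheel[OF n] this] obtain i j where sub: "S \<subseteq> verts (wheel n)"
    and ij: "Inl i \<in> S" "Inl j \<in> S" "\<not> int n dvd 2 * (int i - int j)"
    by blast
  have lt: "i < n" "j < n"
    using subsetD[OF sub ij(1)] subsetD[OF sub ij(2)] by (auto simp: verts_wheel)
  then have det: "determining_set (wheel n) {Inl i, Inl j}"
    using n ij(3) by (intro determining_set_wheel_pair)
  have "S = {Inl i, Inl j}"
  proof (rule ccontr)
    assume "S \<noteq> {Inl i, Inl j}"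
    then have "{Inl i, Inl j} \<subset> S"
      using ij(1,2) by blast
    then show False
      using min det by (simp add: minimal_determining_set_def)
  qed
  then show "\<exists>i j. i < n \<and> j < n \<and> S = {Inl i, Inl j} \<and> \<not> int n dvd 2 * (int i - int j)"
    using lt ij by blast
next
  assume "\<exists>i j. i < n \<and> j < n \<and> S = {Inl i, Inl j} \<and> \<not> int n dvd 2 * (int i - int j)"
  then obtain i j where ij: "i < n" "j < n" "S = {Inl i, Inl j}"
      "\<not> int n dvd 2 * (int i - int j)"
    by blast
  have "\<not> determining_set (wheel n) T" if "T \<subset> S" for T
  proof
    assume "determining_set (wheel n) T"
    from iffD1[OF determining_set_wheel[OF n] this] obtain k l
      where kl: "Inl k \<in> T" "Inl l \<in> T" "\<not> int n dvd 2 * (int k - int l)"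
      by blast
    then have "k \<noteq> l"
      by auto
    moreover have "k \<in> {i, j}" "l \<in> {i, j}"
      using psubset_imp_subset[OF that] kl(1,2) ij(3) by auto
    ultimately have "S = {Inl k, Inl l}"
      using ij(3) by auto
    then have "S \<subseteq> T"
      using kl(1,2) by simp
    then show False
      using that by blast
  qed
  moreover have "determining_set (wheel n) S"
    unfolding ij(3) using n ij(1,2,4) by (rule determining_set_wheel_pair)
  ultimately show "minimal_determining_set (wheel n) S"
    by (simp add: minimal_determining_set_def)
qed

lemma determining_exchange_property_wheel:
  assumes n: "n \<ge> 4"
  shows "determining_exchange_property (wheel n)"
  unfolding determining_exchange_property_def
proof (intro allI impI ballI)
  fix S R r
  assume S: "minimal_determining_set (wheel n) S"
    and R: "minimal_determining_set (wheel n) R" and r: "r \<in> R"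
  obtain a b where ab: "a < n" "b < n" "S = {Inl a, Inl b}" "\<not> int n dvd 2 * (int a - int b)"
    using iffD1[OF minimal_determining_set_wheel[OF n] S] by blast
  obtain c where c: "c < n" "r = Inl c"
    using iffD1[OF minimal_determining_set_wheel[OF n] R] r by auto
  have "a \<noteq> b"
    using ab by auto
  \<comment> \<open>Were \<open>c\<close> equivalent to both, subtracting would make
    \<open>a\<close> and \<open>b\<close> equivalent. The member of \<open>S\<close> inequivalent to
    \<open>c\<close> is kept and the other replaced.\<close>
  have "\<not> int n dvd 2 * (int a - int c) \<or> \<not> int n dvd 2 * (int b - int c)"
  proof (rule ccontr)
    assume "\<not> ?thesis"
    then have "int n dvd 2 * (int a - int c) - 2 * (int b - int c)"
      using dvd_diff by blast
    then show False
      using ab by (simp add: algebra_simps)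
  qed
  then show "\<exists>s \<in> S. minimal_determining_set (wheel n) (S - {s} \<union> {r})"
  proof
    assume neq: "\<not> int n dvd 2 * (int a - int c)"
    have "S - {Inl b} \<union> {r} = {Inl a, Inl c}"
      using ab c \<open>a \<noteq> b\<close> by auto
    then have "minimal_determining_set (wheel n) (S - {Inl b} \<union> {r})"
      unfolding minimal_determining_set_wheel[OF n] using ab(1,2) c(1) neq by blast
    then show ?thesis
      using ab by blast
  next
    assume neq: "\<not> int n dvd 2 * (int b - int c)"
    have "S - {Inl a} \<union> {r} = {Inl b, Inl c}"
      using ab c \<open>a \<noteq> b\<close> by auto
    then have "minimal_determining_set (wheel n) (S - {Inl a} \<union> {r})"
      unfolding minimal_determining_set_wheel[OF n] using ab(1,2) c(1) neq by blast
    then show ?thesis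
      using ab by blast
  qed
qed

theorem theorem14:
  fixes n :: nat
  assumes "n \<ge> 3"
  shows "determining_exchange_property (wheel n)"
proof (cases "n = 3")
  case True
  then show ?thesis
    using complete_graph_wheel_3
      determining_exchange_property_complete_graph[of "wheel 3" "Inl 0" "Inr ()"]
    by (simp add: verts_wheel)
next
  case False
  then show ?thesis
    using assms by (intro determining_exchange_property_wheel) simp
qed

end
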